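(* Let $p\in(0,1)$ and let $(f_n)_{n\ge1}$ be a sequence of functions $f_n:\{0,1\}^n\to[0,1]$. If $$ \lim_{n\to\infty}\mathrm{Var}_{r}\big(\mathbb{E}_{p/r}\big[f_n(\psi\cdot\xi)\,\big|\,\psi\big]\big)=0 $$ for some $r\in(p,1)$, then this limit equals $0$ for every $r\in(p,1)$.
   Context: For $q\in[0,1]$, $\mathbb{P}_q$ is the product measure on $\{0,1\}^n$ giving each coordinate the value $1$ with probability $q$ and $0$ with probability $1-q$; $\mathbb{E}_q$ and $\mathrm{Var}_q$ are the corresponding expectation and variance. The configurations $\psi,\xi\in\{0,1\}^n$ are independent, with $\psi\sim\mathbb{P}_r$ and $\xi\sim\mathbb{P}_{p/r}$, and $\psi\cdot\xi$ is the coordinate-wise product; $\mathbb{E}_{p/r}[f_n(\psi\cdot\xi)\,|\,\psi]$ is the function of $\psi$ obtained by averaging over $\xi\sim\mathbb{P}_{p/r}$ with $\psi$ fixed, and $\mathrm{Var}_r$ of it is taken over $\psi\sim\mathbb{P}_r$. *)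

theory Defs
  imports "HOL-Probability.Probability"
begin

text \<open>A point of \<open>{0,1}\<^sup>n\<close> is a function \<open>nat \<Rightarrow> bool\<close> (with 1 as \<^const>\<open>True\<close>) that is
  \<^const>\<open>False\<close> outside the coordinate set \<open>{1..n}\<close>.\<close>

definition cube :: "nat \<Rightarrow> (nat \<Rightarrow> bool) set" where
  "cube n = PiE_dflt {1..n} False (\<lambda>_. UNIV)"

text \<open>Note that \<^const>\<open>bernoulli_pmf\<close> clips its parameter to \<open>[0,1]\<close>; only \<open>q \<in> [0,1]\<close> is
  meaningful here.\<close>

definition cube_pmf :: "nat \<Rightarrow> real \<Rightarrow> (nat \<Rightarrow> bool) pmf" where
  "cube_pmf n q = Pi_pmf {1..n} False (\<lambda>_. bernoulli_pmf q)"

definition cube_mult :: "(nat \<Rightarrow> bool) \<Rightarrow> (nat \<Rightarrow> bool) \<Rightarrow> nat \<Rightarrow> bool" where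
  "cube_mult \<psi> \<xi> = (\<lambda>i. \<psi> i \<and> \<xi> i)"

definition thinned_expectation ::
    "nat \<Rightarrow> real \<Rightarrow> ((nat \<Rightarrow> bool) \<Rightarrow> real) \<Rightarrow> (nat \<Rightarrow> bool) \<Rightarrow> real" where
  "thinned_expectation n s g \<psi> =
     measure_pmf.expectation (cube_pmf n s) (\<lambda>\<xi>. g (cube_mult \<psi> \<xi>))"

end

theory Submission
  imports Defs
begin

text \<open>
  Put \<open>\<lambda>(r) = p(1 - r) / (r(1 - p))\<close>. In terms of the Fourier--Walsh coefficients \<open>a\<^sub>S\<close> of \<open>f\<^sub>n\<close> with
  respect to \<open>\<P>\<^sub>p\<close>, the variance in question is \<open>\<Sum>\<^bsub>S \<noteq> \<emptyset>\<^esub> a\<^sub>S\<^sup>2 \<lambda>(r)\<^bsup>|S|\<^esup>\<close>: only \<open>\<lambda>(r)\<close>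
  depends on \<open>r\<close>, it lies in \<open>(0,1)\<close>, and the total weight is at most 1 (the case \<open>r = p\<close>).
  Cutting off at level \<open>K\<close> bounds the variance at \<open>t\<close> by the variance at \<open>r\<close> divided by
  \<open>\<lambda>(r)\<^sup>K\<close>, plus \<open>\<lambda>(t)\<^sup>K\<close>; let first \<open>n\<close> and then \<open>K\<close> tend to infinity.
  The level weights are obtained by induction on the coordinates, without naming the \<open>a\<^sub>S\<close>.
\<close>

lemma finite_set_Pi_pmf_bernoulli:
  assumes "finite A"
  shows "finite (set_pmf (Pi_pmf A False (\<lambda>_. bernoulli_pmf q)))"
  by (rule finite_subset[OF set_Pi_pmf_subset'[OF assms]]) (intro finite_PiE_dflt assms finite)

lemma expectation_Pi_pmf_bernoulli_insert:
  fixes h :: "('a \<Rightarrow> bool) \<Rightarrow> real"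
  assumes "finite A" "i \<notin> A" "q \<in> {0..1}"
  shows "measure_pmf.expectation (Pi_pmf (insert i A) False (\<lambda>_. bernoulli_pmf q)) h =
    q * measure_pmf.expectation (Pi_pmf A False (\<lambda>_. bernoulli_pmf q)) (\<lambda>\<eta>. h (\<eta>(i := True))) +
    (1 - q) * measure_pmf.expectation (Pi_pmf A False (\<lambda>_. bernoulli_pmf q)) (\<lambda>\<eta>. h (\<eta>(i := False)))"
proof -
  let ?M = "Pi_pmf A False (\<lambda>_. bernoulli_pmf q)"
  have "Pi_pmf (insert i A) False (\<lambda>_. bernoulli_pmf q) =
      bernoulli_pmf q \<bind> (\<lambda>b. map_pmf (\<lambda>\<eta>. \<eta>(i := b)) ?M)"
    using assms by (simp add: Pi_pmf_insert' map_pmf_def)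
  moreover have "measure_pmf.expectation \<dots> h =
      (\<Sum>b\<in>UNIV. pmf (bernoulli_pmf q) b *\<^sub>R
        measure_pmf.expectation (map_pmf (\<lambda>\<eta>. \<eta>(i := b)) ?M) h)"
    using assms finite_set_Pi_pmf_bernoulli[OF assms(1)] by (intro pmf_expectation_bind) auto
  ultimately show ?thesis
    using assms by (simp add: UNIV_bool)
qed

text \<open>The averaging of \<open>thinned_expectation\<close> over an arbitrary coordinate set, so
  that coordinates can be added one at a time by induction.\<close>

definition thinning :: "'a set \<Rightarrow> real \<Rightarrow> (('a \<Rightarrow> bool) \<Rightarrow> real) \<Rightarrow> ('a \<Rightarrow> bool) \<Rightarrow> real" where
  "thinning A s g \<psi> =
     measure_pmf.expectation (Pi_pmf A False (\<lambda>_. bernoulli_pmf s)) (\<lambda>\<xi>. g (\<lambda>i. \<psi> i \<and> \<xi> i))"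

lemma thinning_lincomb:
  assumes "finite A"
  shows "thinning A s (\<lambda>\<eta>. a * g \<eta> + b * h \<eta>) \<psi> = a * thinning A s g \<psi> + b * thinning A s h \<psi>"
  unfolding thinning_def
  by (subst Bochner_Integration.integral_add)
     (auto intro!: integrable_measure_pmf_finite finite_set_Pi_pmf_bernoulli assms)

lemma thinning_insert:
  assumes "finite A" "i \<notin> A" "s \<in> {0..1}"
  shows "thinning (insert i A) s g (\<psi>(i := True)) =
      s * thinning A s (\<lambda>\<eta>. g (\<eta>(i := True))) \<psi> + (1 - s) * thinning A s (\<lambda>\<eta>. g (\<eta>(i := False))) \<psi>"
    and "thinning (insert i A) s g (\<psi>(i := False)) = thinning A s (\<lambda>\<eta>. g (\<eta>(i := False))) \<psi>"
proof -
  have *: "(\<lambda>j. (\<psi>(i := b)) j \<and> (\<xi>(i := c)) j) = (\<lambda>j. \<psi> j \<and> \<xi> j)(i := b \<and> c)" for b c \<xi>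
    by auto
  show "thinning (insert i A) s g (\<psi>(i := True)) =
      s * thinning A s (\<lambda>\<eta>. g (\<eta>(i := True))) \<psi> + (1 - s) * thinning A s (\<lambda>\<eta>. g (\<eta>(i := False))) \<psi>"
    unfolding thinning_def expectation_Pi_pmf_bernoulli_insert[OF assms] * by simp
  show "thinning (insert i A) s g (\<psi>(i := False)) = thinning A s (\<lambda>\<eta>. g (\<eta>(i := False))) \<psi>"
    unfolding thinning_def expectation_Pi_pmf_bernoulli_insert[OF assms] *
    by (simp add: algebra_simps)
qed

text \<open>\<open>w k\<close> stands for the total squared coefficient at level \<open>k\<close>.
  It is chosen before \<open>r\<close>, which makes different values of \<open>r\<close> comparable.
  \<open>g\<close> stays arbitrary because the induction step uses the hypothesis for two functions,
  \<open>m\<close> and \<open>d\<close>.\<close>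

lemma thinned_moments:
  fixes g :: "('a \<Rightarrow> bool) \<Rightarrow> real"
  assumes "finite A" and p: "0 < p" "p < 1"
  shows "\<exists>c w. (\<forall>k. 0 \<le> w k) \<and> w 0 = c\<^sup>2 \<and> (\<forall>r\<in>{p..<1}.
      measure_pmf.expectation (Pi_pmf A False (\<lambda>_. bernoulli_pmf r)) (thinning A (p / r) g) = c \<and>
      measure_pmf.expectation (Pi_pmf A False (\<lambda>_. bernoulli_pmf r)) (\<lambda>\<psi>. (thinning A (p / r) g \<psi>)\<^sup>2) =
        (\<Sum>k\<le>card A. w k * (p * (1 - r) / (r * (1 - p))) ^ k))"
  using assms(1)
proof (induction A arbitrary: g rule: finite_induct)
  case empty
  show ?case
    by (rule exI[of _ "g (\<lambda>_. False)"], rule exI[of _ "\<lambda>_. (g (\<lambda>_. False))\<^sup>2"])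
       (simp add: thinning_def)
next
  case (insert i A)
  define g0 g1 where "g0 = (\<lambda>\<eta>. g (\<eta>(i := False)))" and "g1 = (\<lambda>\<eta>. g (\<eta>(i := True)))"
  define \<sigma> where "\<sigma> = sqrt (p * (1 - p))"
  \<comment> \<open>\<open>g = m + d \<chi>\<close> with \<open>\<chi> = (x\<^sub>i - p) / \<sigma>\<close> normalised in \<open>L\<^sup>2(\<P>\<^sub>p)\<close>; averaging over \<open>\<xi>\<^sub>i\<close> turns \<open>\<chi>\<close>
      into a function of mean 0 and variance \<open>p(1 - r) / (r(1 - p))\<close> under \<open>\<P>\<^sub>r\<close>.\<close>
  define m where "m = (\<lambda>\<eta>. p * g1 \<eta> + (1 - p) * g0 \<eta>)"
  define d where "d = (\<lambda>\<eta>. \<sigma> * g1 \<eta> + (- \<sigma>) * g0 \<eta>)"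
  have \<sigma>: "\<sigma>\<^sup>2 = p * (1 - p)"
    using p by (simp add: \<sigma>_def)
  let ?E = "\<lambda>r. measure_pmf.expectation (Pi_pmf A False (\<lambda>_. bernoulli_pmf r))"
  let ?E' = "\<lambda>r. measure_pmf.expectation (Pi_pmf (insert i A) False (\<lambda>_. bernoulli_pmf r))"
  let ?l = "\<lambda>r. p * (1 - r) / (r * (1 - p))"
  obtain c w where w: "\<And>k. 0 \<le> w k" "w 0 = c\<^sup>2"
    and cw: "\<And>r. r \<in> {p..<1} \<Longrightarrow> ?E r (thinning A (p / r) m) = c"
      "\<And>r. r \<in> {p..<1} \<Longrightarrow> ?E r (\<lambda>\<psi>. (thinning A (p / r) m \<psi>)\<^sup>2) = (\<Sum>k\<le>card A. w k * ?l r ^ k)"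
    using insert.IH[of m] by blast
  obtain v where v: "\<And>k. 0 \<le> v k"
      "\<And>r. r \<in> {p..<1} \<Longrightarrow> ?E r (\<lambda>\<psi>. (thinning A (p / r) d \<psi>)\<^sup>2) = (\<Sum>k\<le>card A. v k * ?l r ^ k)"
    using insert.IH[of d] by blast
  \<comment> \<open>The part from \<open>d\<close> carries one more factor \<open>?l r\<close>, so
    its weights move up one level. The \<open>if\<close> cuts off \<open>w\<close> above
    \<open>card A\<close>, where it need not vanish.\<close>
  define u where "u k = (if k \<le> card A then w k else 0) + (case k of 0 \<Rightarrow> 0 | Suc j \<Rightarrow> v j)" for k
  show ?case
  proof (intro exI[of _ c] exI[of _ u] conjI ballI allI)
    show "0 \<le> u k" for k
      using w(1) v(1) by (auto simp: u_def split: nat.split)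
    show "u 0 = c\<^sup>2"
      using w(2) by (simp add: u_def)
    fix r assume r: "r \<in> {p..<1}"
    then have r': "r \<in> {0..1}" and s: "p / r \<in> {0..1}" and r0: "0 < r"
      using p by auto
    have integrable: "integrable (Pi_pmf A False (\<lambda>_. bernoulli_pmf r)) h" for h :: "_ \<Rightarrow> real"
      by (intro integrable_measure_pmf_finite finite_set_Pi_pmf_bernoulli insert.hyps)
    let ?G0 = "thinning A (p / r) g0" and ?G1 = "thinning A (p / r) g1"
    have m: "thinning A (p / r) m \<psi> = p * ?G1 \<psi> + (1 - p) * ?G0 \<psi>"
      and d: "thinning A (p / r) d \<psi> = \<sigma> * (?G1 \<psi> - ?G0 \<psi>)" for \<psi>
      using insert.hyps by (simp_all only: m_def d_def thinning_lincomb) (simp add: algebra_simps)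
    \<comment> \<open>Coordinate \<open>i\<close> of \<psi> is 1 with probability \<open>r\<close>,
      and then that of \<xi> with probability \<open>p / r\<close>. Taking \<open>h\<close> as
      identity and as square gives both moments.\<close>
    have E': "?E' r (\<lambda>\<psi>. h (thinning (insert i A) (p / r) g \<psi>)) =
        ?E r (\<lambda>\<psi>. r * h (p / r * ?G1 \<psi> + (1 - p / r) * ?G0 \<psi>) + (1 - r) * h (?G0 \<psi>))"
      for h :: "real \<Rightarrow> real"
      unfolding expectation_Pi_pmf_bernoulli_insert[OF insert.hyps r'] thinning_insert[OF insert.hyps s]
        g0_def g1_def
      by (simp add: integrable)
    have "?E' r (thinning (insert i A) (p / r) g) = ?E r (thinning A (p / r) m)"
      unfolding E'[of "\<lambda>x. x"] m using r0
      by (intro Bochner_Integration.integral_cong refl) (simp add: field_simps)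
    then show "?E' r (thinning (insert i A) (p / r) g) = c"
      using cw(1)[OF r] by simp
    \<comment> \<open>Second moment = squared mean + variance, for the variable equal to
      \<open>p / r * x + (1 - p / r) * y\<close> with probability \<open>r\<close> and to
      \<open>y\<close> otherwise.\<close>
    have sq: "r * (p / r * x + (1 - p / r) * y)\<^sup>2 + (1 - r) * y\<^sup>2 =
        (p * x + (1 - p) * y)\<^sup>2 + ?l r * (\<sigma> * (x - y))\<^sup>2" for x y
      unfolding power_mult_distrib \<sigma> using r0 p
      by (simp add: divide_simps) (simp add: algebra_simps power2_eq_square)
    have "?E' r (\<lambda>\<psi>. (thinning (insert i A) (p / r) g \<psi>)\<^sup>2) =
        ?E r (\<lambda>\<psi>. (thinning A (p / r) m \<psi>)\<^sup>2 + ?l r * (thinning A (p / r) d \<psi>)\<^sup>2)"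
      unfolding E'[of "\<lambda>x. x\<^sup>2"] sq m d ..
    also have "\<dots> = (\<Sum>k\<le>card A. w k * ?l r ^ k) + ?l r * (\<Sum>k\<le>card A. v k * ?l r ^ k)"
      using cw(2)[OF r] v(2)[OF r] integrable by simp
    also have "(\<Sum>k\<le>card A. w k * ?l r ^ k) = 
        (\<Sum>k\<le>Suc (card A). (if k \<le> card A then w k else 0) * ?l r ^ k)"
      by simp
    also have "?l r * (\<Sum>k\<le>card A. v k * ?l r ^ k) =
        (\<Sum>k\<le>Suc (card A). (case k of 0 \<Rightarrow> 0 | Suc j \<Rightarrow> v j) * ?l r ^ k)"
      by (subst sum.atMost_Suc_shift) (simp add: sum_distrib_left mult_ac)
    finally show "?E' r (\<lambda>\<psi>. (thinning (insert i A) (p / r) g \<psi>)\<^sup>2) =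
        (\<Sum>k\<le>card (insert i A). u k * ?l r ^ k)"
      by (simp only: u_def distrib_right sum.distrib card_insert_disjoint[OF insert.hyps])
  qed
qed

lemma thinned_expectation_eq_thinning: "thinned_expectation n s g = thinning {1..n} s g"
  by (simp add: fun_eq_iff thinned_expectation_def thinning_def cube_mult_def cube_pmf_def)

lemma thinned_expectation_bounds:
  assumes "\<And>\<eta>. \<eta> \<in> cube n \<Longrightarrow> g \<eta> \<in> {0..1}" "\<psi> \<in> cube n"
  shows "thinned_expectation n s g \<psi> \<in> {0..1}"
proof -
  \<comment> \<open>\<psi> already vanishes outside \<open>{1..n}\<close>, so any \<xi> will
    do.\<close>
  have "cube_mult \<psi> \<xi> \<in> cube n" for \<xi>
    using assms(2) by (auto simp: cube_def cube_mult_def PiE_dflt_def)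
  then have *: "0 \<le> g (cube_mult \<psi> \<xi>)" "g (cube_mult \<psi> \<xi>) \<le> 1" for \<xi>
    using assms(1) by (meson atLeastAtMost_iff)+
  have "integrable (cube_pmf n s) (\<lambda>\<xi>. g (cube_mult \<psi> \<xi>))"
    unfolding cube_pmf_def by (intro integrable_measure_pmf_finite finite_set_Pi_pmf_bernoulli) simp
  then show ?thesis
    using * by (auto simp: thinned_expectation_def intro!: integral_nonneg measure_pmf.integral_le_const)
qed

text \<open>Subtracting the squared mean removes exactly level 0, as \<open>w 0 = c\<^sup>2\<close>.
  The bound on the other weights comes from the endpoint \<open>r = p\<close>.\<close>

lemma thinned_variance_power_sum:
  assumes p: "0 < p" "p < 1" and g: "\<And>\<eta>. \<eta> \<in> cube n \<Longrightarrow> g \<eta> \<in> {0..1}"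
  shows "\<exists>w. (\<forall>k. 0 \<le> w k) \<and> (\<Sum>k=1..n. w k) \<le> 1 \<and> (\<forall>r\<in>{p..<1}.
      measure_pmf.variance (cube_pmf n r) (thinned_expectation n (p / r) g) =
        (\<Sum>k=1..n. w k * (p * (1 - r) / (r * (1 - p))) ^ k))"
proof -
  let ?l = "\<lambda>r. p * (1 - r) / (r * (1 - p))" and ?X = "\<lambda>r. thinned_expectation n (p / r) g"
  obtain c w where w: "\<And>k. 0 \<le> w k" "w 0 = c\<^sup>2"
    and c: "\<And>r. r \<in> {p..<1} \<Longrightarrow> measure_pmf.expectation (cube_pmf n r) (?X r) = c"
    and sq: "\<And>r. r \<in> {p..<1} \<Longrightarrow> measure_pmf.expectation (cube_pmf n r) (\<lambda>\<psi>. (?X r \<psi>)\<^sup>2) =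
        (\<Sum>k\<le>n. w k * ?l r ^ k)"
    using thinned_moments[OF finite_atLeastAtMost p, of 1 n g]
    unfolding thinned_expectation_eq_thinning cube_pmf_def card_atLeastAtMost diff_Suc_1 by blast
  have integrable: "integrable (cube_pmf n r) h" for h :: "_ \<Rightarrow> real" and r
    unfolding cube_pmf_def by (intro integrable_measure_pmf_finite finite_set_Pi_pmf_bernoulli) simp
  have drop_level_0: "(\<Sum>k\<le>n. w k * x ^ k) = c\<^sup>2 + (\<Sum>k=1..n. w k * x ^ k)" for x :: real
    using w(2) by (simp add: atMost_atLeast0 sum.atLeast_Suc_atMost)
  have "set_pmf (cube_pmf n p) \<subseteq> cube n"
    unfolding cube_pmf_def cube_def using set_Pi_pmf_subset'[of "{1..n}" False "\<lambda>_. bernoulli_pmf p"]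
    by (auto simp: PiE_dflt_def)
  then have "AE \<psi> in cube_pmf n p. (?X p \<psi>)\<^sup>2 \<le> 1"
    using thinned_expectation_bounds[of n g] g by (auto simp: AE_measure_pmf_iff abs_square_le_1)
  then have "measure_pmf.expectation (cube_pmf n p) (\<lambda>\<psi>. (?X p \<psi>)\<^sup>2) \<le> 1"
    by (intro measure_pmf.integral_le_const integrable)
  \<comment> \<open>Since \<open>?l p = 1\<close>, the second moment at \<open>p\<close> is the
    plain sum of all weights.\<close>
  then have "c\<^sup>2 + (\<Sum>k=1..n. w k) \<le> 1"
    using sq[of p] p drop_level_0[of 1] by simp
  then have "(\<Sum>k=1..n. w k) \<le> 1"
    using zero_le_power2[of c] by linarith
  moreover have "measure_pmf.variance (cube_pmf n r) (?X r) = (\<Sum>k=1..n. w k * ?l r ^ k)"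
    if "r \<in> {p..<1}" for r
    using measure_pmf.variance_eq[OF integrable integrable, of r "?X r"] c[OF that] sq[OF that] drop_level_0
    by simp
  ultimately show ?thesis
    using w(1) by blast
qed

text \<open>Termwise, \<open>x ^ k / x ^ K\<close> is at least 1 for \<open>k \<le> K\<close>, while
  \<open>y ^ k \<le> y ^ K\<close> for larger \<open>k\<close>. As the total weight is at most 1,
  the error \<open>y ^ K\<close> does not depend on \<open>S\<close> or \<open>w\<close>.\<close>

lemma power_sum_compare:
  fixes w :: "nat \<Rightarrow> real"
  assumes "finite S" "\<And>k. k \<in> S \<Longrightarrow> 0 \<le> w k" "sum w S \<le> 1" and x: "0 < x" "x \<le> 1" and y: "0 \<le> y" "y \<le> 1"
  shows "(\<Sum>k\<in>S. w k * y ^ k) \<le> (\<Sum>k\<in>S. w k * x ^ k) / x ^ K + y ^ K"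
proof -
  have "y ^ k \<le> x ^ k / x ^ K + y ^ K" for k
  proof (cases "k \<le> K")
    case True
    then have "y ^ k \<le> 1" "1 \<le> x ^ k / x ^ K" "0 \<le> y ^ K"
      using x y by (auto simp: power_le_one power_decreasing)
    then show ?thesis by linarith
  next
    case False
    then have "y ^ k \<le> y ^ K" "0 \<le> x ^ k / x ^ K"
      using x y by (auto simp: power_decreasing)
    then show ?thesis by linarith
  qed
  then have "(\<Sum>k\<in>S. w k * y ^ k) \<le> (\<Sum>k\<in>S. w k * (x ^ k / x ^ K + y ^ K))"
    using assms by (intro sum_mono mult_left_mono) auto
  also have "\<dots> = (\<Sum>k\<in>S. w k * x ^ k) / x ^ K + sum w S * y ^ K"
    by (simp add: distrib_left sum.distrib sum_divide_distrib sum_distrib_right)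
  also have "sum w S * y ^ K \<le> y ^ K"
    using assms(3) y by (intro mult_left_le_one_le sum_nonneg assms) auto
  finally show ?thesis by simp
qed

theorem proposition6:
  fixes p :: real and f :: "nat \<Rightarrow> (nat \<Rightarrow> bool) \<Rightarrow> real"
  assumes "p \<in> {0<..<1}"
    and "\<And>n \<omega>. n \<ge> 1 \<Longrightarrow> \<omega> \<in> cube n \<Longrightarrow> f n \<omega> \<in> {0..1}"
    and "\<exists>r\<in>{p<..<1}.
      (\<lambda>n. measure_pmf.variance (cube_pmf n r) (thinned_expectation n (p / r) (f n))) \<longlonglongrightarrow> 0"
  shows "\<forall>r\<in>{p<..<1}.
      (\<lambda>n. measure_pmf.variance (cube_pmf n r) (thinned_expectation n (p / r) (f n))) \<longlonglongrightarrow> 0"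
proof
  fix t assume t: "t \<in> {p<..<1}"
  define V where "V r n = measure_pmf.variance (cube_pmf n r) (thinned_expectation n (p / r) (f n))" for r n
  obtain r where r: "r \<in> {p<..<1}" and lim: "V r \<longlonglongrightarrow> 0"
    using assms(3) unfolding V_def by blast
  have p: "0 < p" "p < 1" using assms(1) by auto
  define l where "l r = p * (1 - r) / (r * (1 - p))" for r
  have l: "0 < l q" "l q < 1" if "q \<in> {p<..<1}" for q
    using that p by (auto simp: l_def field_simps intro!: divide_pos_pos)
  \<comment> \<open>The weights vary with \<open>n\<close>, but for each \<open>n\<close> the same
    ones serve \<open>r\<close> and \<open>t\<close>.\<close>
  have bound: "V t n \<le> V r n / l r ^ K + l t ^ K" if n: "n \<ge> 1" for n K
  proof -
    obtain w where "\<And>k. 0 \<le> w k" "(\<Sum>k=1..n. w k) \<le> 1"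
        "\<And>q. q \<in> {p..<1} \<Longrightarrow> V q n = (\<Sum>k=1..n. w k * l q ^ k)"
      using thinned_variance_power_sum[OF p, of n "f n"] assms(2)[OF n] unfolding V_def l_def by blast
    then show ?thesis
      using power_sum_compare[of "{1..n}" w "l r" "l t" K] l[OF r] l[OF t] r t by simp
  qed
  have "V t \<longlonglongrightarrow> 0"
  proof (rule LIMSEQ_I)
    fix e :: real assume e: "0 < e"
    \<comment> \<open>\<open>K\<close> depends only on \<open>t\<close> and \<open>e\<close>, so
      \<open>l r ^ K\<close> is a fixed positive constant as \<open>n\<close> grows.\<close>
    obtain K where K: "l t ^ K < e / 2"
      using real_arch_pow_inv[of "e / 2" "l t"] e l[OF t] by auto
    have "eventually (\<lambda>n. V r n < e / 2 * l r ^ K) sequentially"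
      using e l[OF r] by (intro order_tendstoD(2)[OF lim]) simp
    then obtain N where N: "\<And>n. n \<ge> N \<Longrightarrow> V r n < e / 2 * l r ^ K"
      by (auto simp: eventually_sequentially)
    \<comment> \<open>The maximum with 1 is there because \<open>f 0\<close> is not assumed
      bounded.\<close>
    have "norm (V t n - 0) < e" if "n \<ge> max 1 N" for n
    proof -
      have "V r n / l r ^ K < e / 2"
        using N[of n] that l[OF r] by (simp add: pos_divide_less_eq)
      moreover have "0 \<le> V t n"
        unfolding V_def by simp
      ultimately show ?thesis
        using bound[of n K] that K by (simp only: real_norm_def) linarith
    qed
    then show "\<exists>N. \<forall>n\<ge>N. norm (V t n - 0) < e" by blast
  qed
  then show "(\<lambda>n. measure_pmf.variance (cube_pmf n t) (thinned_expectation n (p / t) (f n))) \<longlonglongrightarrow> 0"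
    unfolding V_def .
qed
end
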